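(* Let $G$ be a non-trivial group, let $\mathcal{C}$ be a joinable compression family for $G$, and let $H = \langle A \mid A \in \mathcal{C}\rangle$ be the subgroup of $G$ generated by $\mathcal{C}$. Then: (i) The derived subgroup $\mathrm{D}(H)$ is the monolith of $G$. (ii) If $H$ is semi-transitive on $\mathcal{C}$, then $\mathrm{D}(H)$ is simple. (iii) If $\mathcal{C}$ is a shift-joinable compression family for $H$, then $\mathrm{D}(H) = H$ is the monolith of $G$ and is simple.
   Context: The monolith of a group is the intersection of all its non-trivial normal subgroups. $\mathrm{D}(G)$ denotes the derived (commutator) subgroup of $G$. Let $G$ be a non-trivial group, $\mathcal{C}$ a family of subgroups of $G$ invariant under conjugation in $G$, and $H \le G$. Consider the conditions: (A) Every $A \in \mathcal{C}$ is non-abelian. (B) For every $g \in H \setminus \{1\}$ there is $A \in \mathcal{C}$ such that $[A, gAg^{-1}] = \{1\}$. (C) For all $A,B \in \mathcal{C}$ there is $g \in H$ such that $gAg^{-1} \le B$. (D) Given $A,B,C \in \mathcal{C}$ such that $[A,C]=\{1\}$ and $C \nleq B$, there exists $D \in \mathcal{C}$ such that $\langle A,B\rangle \le D$. (E) For every $A \in \mathcal{C}$ there is $g \in H$ and a homomorphism $(-)^\bullet : \prod_{i\ge 1} A \to H$ (from the full direct product of countably many copies of $A$) such that $(a,1,1,\dots)^\bullet = a$ for all $a \in A$, and $g(a_1,a_2,a_3,\dots)^\bullet g^{-1} = (1,a_1,a_2,\dots)^\bullet$ for all $(a_i)_{i\ge1} \in \prod_{i\ge1}A$. $H$ is semi-transitive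 on $\mathcal{C}$ if (C) holds. $\mathcal{C}$ is a joinable compression family for $H$ if (A)--(D) hold, and a shift-joinable compression family for $H$ if (A)--(E) hold. "For $G$" means these conditions hold with $H$ replaced by $G$. *)

theory Defs
  imports "HOL-Algebra.Generated_Groups" "HOL-Algebra.Product_Groups"
begin

text \<open>Subgroups of \<open>G\<close> are given by their carrier sets; where a subgroup \<open>A\<close> is used as a
  group in its own right, it is the structure \<open>G\<lparr>carrier := A\<rparr>\<close>.\<close>

text \<open>The intersection is relativised to \<open>carrier G\<close>, which only matters for trivial \<open>G\<close>.\<close>

definition monolith :: "('a, 'b) monoid_scheme \<Rightarrow> 'a set" where
  "monolith G = carrier G \<inter> \<Inter> {N. N \<lhd> G \<and> N \<noteq> {\<one>\<^bsub>G\<^esub>}}"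

text \<open>The library locale \<open>simple_group\<close> is not usable here: it demands \<open>order G > 1\<close>, and
  since \<open>order\<close> is defined through \<open>card\<close>, this excludes all infinite groups.\<close>

definition is_simple :: "('a, 'b) monoid_scheme \<Rightarrow> bool" where
  "is_simple G \<longleftrightarrow> group G \<and> carrier G \<noteq> {\<one>\<^bsub>G\<^esub>} \<and>
     (\<forall>N. N \<lhd> G \<longrightarrow> N = {\<one>\<^bsub>G\<^esub>} \<or> N = carrier G)"

definition conjugate :: "('a, 'b) monoid_scheme \<Rightarrow> 'a \<Rightarrow> 'a set \<Rightarrow> 'a set" where
  "conjugate G g A = (g <#\<^bsub>G\<^esub> A) #>\<^bsub>G\<^esub> (inv\<^bsub>G\<^esub> g)"

text \<open>\<open>[A, B]\<close>; the convention for commutators is that of the library's \<open>derived\<close>,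
  so that \<open>commutator_subgroup G A A\<close> is \<open>derived G A\<close>.\<close>

definition commutator_subgroup :: "('a, 'b) monoid_scheme \<Rightarrow> 'a set \<Rightarrow> 'a set \<Rightarrow> 'a set" where
  "commutator_subgroup G A B =
     generate G (\<Union>a\<in>A. \<Union>b\<in>B. {a \<otimes>\<^bsub>G\<^esub> b \<otimes>\<^bsub>G\<^esub> inv\<^bsub>G\<^esub> a \<otimes>\<^bsub>G\<^esub> inv\<^bsub>G\<^esub> b})"

definition conjugation_invariant_family :: "('a, 'b) monoid_scheme \<Rightarrow> 'a set set \<Rightarrow> bool" where
  "conjugation_invariant_family G \<C> \<longleftrightarrow>
     (\<forall>A\<in>\<C>. subgroup A G) \<and> (\<forall>g\<in>carrier G. \<forall>A\<in>\<C>. conjugate G g A \<in> \<C>)"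

text \<open>Conditions (A)--(E) for a family \<open>\<C>\<close> of subgroups of \<open>G\<close> and a subgroup \<open>H\<close> of \<open>G\<close>.\<close>

definition all_nonabelian :: "('a, 'b) monoid_scheme \<Rightarrow> 'a set set \<Rightarrow> bool" where
  "all_nonabelian G \<C> \<longleftrightarrow> (\<forall>A\<in>\<C>. \<not> comm_group (G\<lparr>carrier := A\<rparr>))"

definition displaceable :: "('a, 'b) monoid_scheme \<Rightarrow> 'a set set \<Rightarrow> 'a set \<Rightarrow> bool" where
  "displaceable G \<C> H \<longleftrightarrow>
     (\<forall>g \<in> H - {\<one>\<^bsub>G\<^esub>}. \<exists>A\<in>\<C>. commutator_subgroup G A (conjugate G g A) = {\<one>\<^bsub>G\<^esub>})"

definition semi_transitive :: "('a, 'b) monoid_scheme \<Rightarrow> 'a set set \<Rightarrow> 'a set \<Rightarrow> bool" where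
  "semi_transitive G \<C> H \<longleftrightarrow> (\<forall>A\<in>\<C>. \<forall>B\<in>\<C>. \<exists>g\<in>H. conjugate G g A \<subseteq> B)"

definition joinable :: "('a, 'b) monoid_scheme \<Rightarrow> 'a set set \<Rightarrow> bool" where
  "joinable G \<C> \<longleftrightarrow>
     (\<forall>A\<in>\<C>. \<forall>B\<in>\<C>. \<forall>C\<in>\<C>. commutator_subgroup G A C = {\<one>\<^bsub>G\<^esub>} \<and> \<not> C \<subseteq> B \<longrightarrow>
        (\<exists>D\<in>\<C>. generate G (A \<union> B) \<subseteq> D))"

text \<open>Sequences are indexed from \<open>0\<close>; \<open>case_nat a x\<close> is the sequence \<open>a, x 0, x 1, \<dots>\<close>.\<close>

definition shiftable :: "('a, 'b) monoid_scheme \<Rightarrow> 'a set set \<Rightarrow> 'a set \<Rightarrow> bool" where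
  "shiftable G \<C> H \<longleftrightarrow>
     (\<forall>A\<in>\<C>. \<exists>g\<in>H.
        \<exists>\<phi> \<in> hom (product_group (UNIV :: nat set) (\<lambda>_. G\<lparr>carrier := A\<rparr>)) (G\<lparr>carrier := H\<rparr>).
          (\<forall>a\<in>A. \<phi> (case_nat a (\<lambda>_. \<one>\<^bsub>G\<^esub>)) = a) \<and>
          (\<forall>x \<in> carrier (product_group (UNIV :: nat set) (\<lambda>_. G\<lparr>carrier := A\<rparr>)).
             g \<otimes>\<^bsub>G\<^esub> \<phi> x \<otimes>\<^bsub>G\<^esub> inv\<^bsub>G\<^esub> g = \<phi> (case_nat \<one>\<^bsub>G\<^esub> x)))"

definition joinable_compression_family ::
    "('a, 'b) monoid_scheme \<Rightarrow> 'a set set \<Rightarrow> 'a set \<Rightarrow> bool" where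
  "joinable_compression_family G \<C> H \<longleftrightarrow>
     subgroup H G \<and> conjugation_invariant_family G \<C> \<and>
     all_nonabelian G \<C> \<and> displaceable G \<C> H \<and> semi_transitive G \<C> H \<and> joinable G \<C>"

definition shift_joinable_compression_family ::
    "('a, 'b) monoid_scheme \<Rightarrow> 'a set set \<Rightarrow> 'a set \<Rightarrow> bool" where
  "shift_joinable_compression_family G \<C> H \<longleftrightarrow>
     joinable_compression_family G \<C> H \<and> shiftable G \<C> H"

end

theory Submission
  imports Defs
begin

text \<open>If \<open>n\<close> lies in a subgroup \<open>N\<close> and displaces \<open>A\<close> from itself, so that \<open>A\<close> and \<open>n A n\<inverse>\<close>
  commute, then \<open>[u, v] = [[u, n], v]\<close> for \<open>u, v \<in> A\<close>; hence \<open>N\<close> contains \<open>[u, v]\<close> as soon as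
  \<open>u\<close> and \<open>v\<close> normalise \<open>N\<close>. For \<open>N\<close> normal in \<open>G\<close> this puts \<open>D(A)\<close> into \<open>N\<close> for all
  \<open>A \<in> \<C>\<close>. Joinability then gives \<open>[A, B] \<le> N\<close>: with \<open>C = n A n\<inverse>\<close> commuting with \<open>A\<close>, either
  \<open>C \<le> B\<close>, and \<open>A\<close> and \<open>C\<close> agree modulo \<open>N\<close>, or \<open>A\<close> and \<open>B\<close> lie in a common member of \<open>\<C>\<close>.

  For \<open>N\<close> normal only in \<open>D(H)\<close>, the elements \<open>u\<close> and \<open>v\<close> must lie in \<open>D(H)\<close>. Below every
  \<open>A \<in> \<C>\<close> there are \<open>F \<in> \<C>\<close> and \<open>k, l \<in> A\<close> such that \<open>F\<close>, \<open>k F k\<inverse>\<close> and \<open>l F l\<inverse>\<close> commute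
  pairwise, and for \<open>a, b \<in> F\<close> one has \<open>[a, b] = [[a, k], [b, l]]\<close>. So \<open>N\<close> contains \<open>D(F)\<close> for
  some \<open>F\<close>, and therefore for all, as \<open>D(H)\<close> and \<open>H\<close> have the same orbits on \<open>\<C>\<close>; the \<open>D(F)\<close>
  generate a normal subgroup of \<open>G\<close>, to which the first part applies.\<close>

section \<open>Commuting subsets and conjugates\<close>

definition elementwise_commuting :: "('a, 'b) monoid_scheme \<Rightarrow> 'a set \<Rightarrow> 'a set \<Rightarrow> bool" where
  "elementwise_commuting G A B \<longleftrightarrow> (\<forall>a\<in>A. \<forall>b\<in>B. a \<otimes>\<^bsub>G\<^esub> b = b \<otimes>\<^bsub>G\<^esub> a)"

lemma elementwise_commutingD:
  "\<lbrakk>elementwise_commuting G A B; a \<in> A; b \<in> B\<rbrakk> \<Longrightarrow> a \<otimes>\<^bsub>G\<^esub> b = b \<otimes>\<^bsub>G\<^esub> a"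
  unfolding elementwise_commuting_def by blast

lemma elementwise_commuting_mono:
  "\<lbrakk>elementwise_commuting G A B; A' \<subseteq> A; B' \<subseteq> B\<rbrakk> \<Longrightarrow> elementwise_commuting G A' B'"
  unfolding elementwise_commuting_def by blast

lemma conjugate_eq_image: "conjugate G g A = (\<lambda>x. g \<otimes>\<^bsub>G\<^esub> x \<otimes>\<^bsub>G\<^esub> inv\<^bsub>G\<^esub> g) ` A"
  by (auto simp: conjugate_def l_coset_def r_coset_def)

lemma conjugate_mono: "A \<subseteq> B \<Longrightarrow> conjugate G g A \<subseteq> conjugate G g B"
  by (auto simp: conjugate_eq_image)

lemma mem_conjugate: "x \<in> A \<Longrightarrow> g \<otimes>\<^bsub>G\<^esub> x \<otimes>\<^bsub>G\<^esub> inv\<^bsub>G\<^esub> g \<in> conjugate G g A"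
  by (auto simp: conjugate_eq_image)

section \<open>Commutator identities\<close>

context group
begin

abbreviation commutator :: "'a \<Rightarrow> 'a \<Rightarrow> 'a" where
  "commutator x y \<equiv> x \<otimes> y \<otimes> inv x \<otimes> inv y"

lemma inv_m_cancel: "\<lbrakk>x \<in> carrier G; y \<in> carrier G\<rbrakk> \<Longrightarrow> inv x \<otimes> (x \<otimes> y) = y"
  by (simp add: m_assoc[symmetric])

lemma m_inv_cancel: "\<lbrakk>x \<in> carrier G; y \<in> carrier G\<rbrakk> \<Longrightarrow> x \<otimes> (inv x \<otimes> y) = y"
  by (simp add: m_assoc[symmetric])

lemmas group_normalize = m_assoc inv_mult_group inv_m_cancel m_inv_cancel

lemma commutator_eq_one_iff:
  assumes "x \<in> carrier G" "y \<in> carrier G"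
  shows "commutator x y = \<one> \<longleftrightarrow> x \<otimes> y = y \<otimes> x"
proof -
  have "commutator x y = (x \<otimes> y) \<otimes> inv (y \<otimes> x)"
    using assms by (simp add: group_normalize)
  then show ?thesis
    using assms by (simp add: inv_solve_right')
qed

lemma inv_commutator:
  assumes "x \<in> carrier G" "y \<in> carrier G"
  shows "inv (commutator x y) = commutator y x"
  using assms by (simp add: group_normalize)

lemma commuting_mult_right:
  assumes "x \<in> carrier G" "y \<in> carrier G" "z \<in> carrier G"
    and "x \<otimes> y = y \<otimes> x" "x \<otimes> z = z \<otimes> x"
  shows "x \<otimes> (y \<otimes> z) = (y \<otimes> z) \<otimes> x"
proof -
  have "x \<otimes> (y \<otimes> z) = y \<otimes> (x \<otimes> z)"
    using assms(1-3) by (simp add: m_assoc[symmetric] assms(4))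
  then show ?thesis
    using assms(1-3) by (simp add: m_assoc assms(5))
qed

lemma commuting_conj_eq:
  assumes "x \<in> carrier G" "y \<in> carrier G" "x \<otimes> y = y \<otimes> x"
  shows "x \<otimes> y \<otimes> inv x = y"
  using assms by (simp only: inv_solve_right' m_closed)

text \<open>Since \<open>x\<close> commutes with \<open>v\<close>, conjugating \<open>v\<close> by
  \<open>u \<otimes> x\<close> amounts to conjugating it by \<open>u\<close>.\<close>

lemma commutator_mult_commuting_left:
  assumes "u \<in> carrier G" "v \<in> carrier G" "x \<in> carrier G" "x \<otimes> v = v \<otimes> x"
  shows "commutator (u \<otimes> x) v = commutator u v"
proof -
  have "commutator (u \<otimes> x) v = u \<otimes> (x \<otimes> v \<otimes> inv x) \<otimes> inv u \<otimes> inv v"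
    using assms(1-3) by (simp add: group_normalize)
  then show ?thesis
    using commuting_conj_eq[OF assms(3,2,4)] by simp
qed

lemma commutator_mult_commuting_right:
  assumes "u \<in> carrier G" "v \<in> carrier G" "x \<in> carrier G" "x \<otimes> u = u \<otimes> x"
  shows "commutator u (v \<otimes> x) = commutator u v"
  using inv_commutator[of "v \<otimes> x" u] inv_commutator[of v u]
    commutator_mult_commuting_left[OF assms(2,1,3,4)] assms(1-3) by simp

section \<open>Commutators modulo a normal subgroup\<close>

text \<open>The set is the preimage in \<open>G\<close> of the centraliser of the image of
  \<open>T\<close> in the quotient by \<open>N\<close>; the commutator form avoids working with
  cosets.\<close>

lemma subgroup_commutators_left:
  assumes N: "N \<lhd> G" and T: "T \<subseteq> carrier G"
  shows "subgroup {x \<in> carrier G. \<forall>y\<in>T. commutator x y \<in> N} G" (is "subgroup ?Z G")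
proof -
  interpret N: normal N G by (fact N)
  show ?thesis
  proof (rule subgroupI)
    show "?Z \<subseteq> carrier G" by blast
    have "\<one> \<in> ?Z" using T by (auto simp: subset_iff)
    then show "?Z \<noteq> {}" by blast
  next
    fix x assume x: "x \<in> ?Z"
    have "commutator (inv x) y \<in> N" if y: "y \<in> T" for y
    proof -
      have yc: "y \<in> carrier G" using y T by blast
      have "inv x \<otimes> inv (commutator x y) \<otimes> x \<in> N"
        using x y by (intro N.inv_op_closed1[OF _ N.m_inv_closed]) auto
      moreover have "inv x \<otimes> inv (commutator x y) \<otimes> x = commutator (inv x) y"
        using x yc by (simp add: group_normalize)
      ultimately show ?thesis by simp
    qed
    then show "inv x \<in> ?Z" using x by simp
  next
    fix x z assume x: "x \<in> ?Z" and z: "z \<in> ?Z"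
    have "commutator (x \<otimes> z) y \<in> N" if y: "y \<in> T" for y
    proof -
      have yc: "y \<in> carrier G" using y T by blast
      have "x \<otimes> commutator z y \<otimes> inv x \<otimes> commutator x y \<in> N"
        using x y z by (intro N.m_closed[of "x \<otimes> commutator z y \<otimes> inv x"] N.inv_op_closed2) auto
      moreover have "x \<otimes> commutator z y \<otimes> inv x \<otimes> commutator x y = commutator (x \<otimes> z) y"
        using x z yc by (simp add: group_normalize)
      ultimately show ?thesis by simp
    qed
    then show "x \<otimes> z \<in> ?Z" using x z by simp
  qed
qed

text \<open>Modulo \<open>N\<close>, elements commuting with all generators form a subgroup. Using
  this once for each argument of the commutator passes from \<open>S\<close> to
  \<open>generate G S\<close>.\<close>

lemma derived_generate_incl:
  assumes N: "N \<lhd> G" and S: "S \<subseteq> carrier G"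
    and comm: "\<And>x y. \<lbrakk>x \<in> S; y \<in> S\<rbrakk> \<Longrightarrow> commutator x y \<in> N"
  shows "derived G (generate G S) \<subseteq> N"
proof -
  interpret N: normal N G by (fact N)
  have gen: "generate G S \<subseteq> carrier G"
    using S by (rule generate_incl)
  have "generate G S \<subseteq> {x \<in> carrier G. \<forall>y\<in>S. commutator x y \<in> N}"
    using comm S by (intro generate_subgroup_incl subgroup_commutators_left[OF N S]) blast
  \<comment> \<open>Inverting the commutator swaps its arguments, so the same centraliser argument
    applies to the other side.\<close>
  then have "commutator y x \<in> N" if "x \<in> generate G S" "y \<in> S" for x y
    using that S gen inv_commutator[of x y] N.m_inv_closed[of "commutator x y"]
    by (auto simp: subset_iff)
  then have "generate G S \<subseteq> {x \<in> carrier G. \<forall>y\<in>generate G S. commutator x y \<in> N}"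
    using S by (intro generate_subgroup_incl subgroup_commutators_left[OF N gen]) blast
  then have "derived_set G (generate G S) \<subseteq> N"
    by blast
  then show ?thesis
    unfolding derived_def using N.is_subgroup by (rule generate_subgroup_incl)
qed

lemma commutator_mem_derived:
  "\<lbrakk>x \<in> K; y \<in> K\<rbrakk> \<Longrightarrow> commutator x y \<in> derived G K"
  unfolding derived_def by (intro generate.incl) blast

section \<open>Centralising, conjugating and displacing subsets\<close>

lemma elementwise_commutingI:
  assumes "A \<subseteq> carrier G" "B \<subseteq> carrier G" "commutator_subgroup G A B = {\<one>}"
  shows "elementwise_commuting G A B"
  unfolding elementwise_commuting_def
proof (intro ballI)
  fix a b assume ab: "a \<in> A" "b \<in> B"
  have "commutator a b \<in> commutator_subgroup G A B"
    unfolding commutator_subgroup_def using ab by (intro generate.incl) blast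
  then have "commutator a b = \<one>"
    using assms(3) by simp
  then show "a \<otimes> b = b \<otimes> a"
    using commutator_eq_one_iff[of a b] assms(1,2) ab by blast
qed

lemma commutator_subgroup_trivial:
  assumes "A \<subseteq> carrier G" "B \<subseteq> carrier G" "elementwise_commuting G A B"
  shows "commutator_subgroup G A B = {\<one>}"
proof -
  have "(\<Union>a\<in>A. \<Union>b\<in>B. {commutator a b}) \<subseteq> {\<one>}"
    using assms(1,2) commutator_eq_one_iff elementwise_commutingD[OF assms(3)] by blast
  then have "commutator_subgroup G A B \<subseteq> {\<one>}"
    unfolding commutator_subgroup_def by (intro generate_subgroup_incl triv_subgroup)
  then show ?thesis
    using generate.one unfolding commutator_subgroup_def by blast
qed

lemma conjugate_mult:
  assumes "g \<in> carrier G" "h \<in> carrier G" "A \<subseteq> carrier G"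
  shows "conjugate G (g \<otimes> h) A = conjugate G g (conjugate G h A)"
  unfolding conjugate_eq_image image_image
  using assms by (intro image_cong) (auto simp: group_normalize subset_iff)

lemma conjugate_one: "A \<subseteq> carrier G \<Longrightarrow> conjugate G \<one> A = A"
  by (force simp: conjugate_eq_image subset_iff)

lemma elementwise_commuting_conjugate:
  assumes g: "g \<in> carrier G" and A: "A \<subseteq> carrier G" and B: "B \<subseteq> carrier G"
    and comm: "elementwise_commuting G A B"
  shows "elementwise_commuting G (conjugate G g A) (conjugate G g B)"
proof -
  have "(g \<otimes> a \<otimes> inv g) \<otimes> (g \<otimes> b \<otimes> inv g) = (g \<otimes> b \<otimes> inv g) \<otimes> (g \<otimes> a \<otimes> inv g)"
    if ab: "a \<in> A" "b \<in> B" for a b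
  proof -
    have c: "a \<in> carrier G" "b \<in> carrier G" using ab A B by auto
    have "(g \<otimes> a \<otimes> inv g) \<otimes> (g \<otimes> b \<otimes> inv g) = g \<otimes> (a \<otimes> b) \<otimes> inv g"
      using g c by (simp add: group_normalize)
    also have "\<dots> = g \<otimes> (b \<otimes> a) \<otimes> inv g"
      using elementwise_commutingD[OF comm ab] by simp
    also have "\<dots> = (g \<otimes> b \<otimes> inv g) \<otimes> (g \<otimes> a \<otimes> inv g)"
      using g c by (simp add: group_normalize)
    finally show ?thesis .
  qed
  then show ?thesis
    by (auto simp: elementwise_commuting_def conjugate_eq_image)
qed

text \<open>Only \<open>u\<close> and \<open>v\<close> are asked to normalise \<open>N\<close>, so
  that the lemma serves both for \<open>N\<close> normal in \<open>G\<close> and for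
  \<open>N\<close> normal only in the derived subgroup of
  \<open>generate G (\<Union>\<C>)\<close>.\<close>

lemma commutator_mem_if_displaced:
  assumes N: "subgroup N G" and n: "n \<in> N"
    and A: "subgroup A G" "elementwise_commuting G A (conjugate G n A)"
    and uv: "u \<in> A" "v \<in> A"
    and norm: "\<And>x. x \<in> N \<Longrightarrow> u \<otimes> x \<otimes> inv u \<in> N" "\<And>x. x \<in> N \<Longrightarrow> v \<otimes> x \<otimes> inv v \<in> N"
  shows "commutator u v \<in> N"
proof -
  have c: "u \<in> carrier G" "v \<in> carrier G" "n \<in> carrier G"
    using uv n N A(1) by (auto dest: subgroup.mem_carrier)
  \<comment> \<open>This \<open>x\<close> lies in \<open>n A n\<inverse>\<close>, hence commutes
    with \<open>v\<close>, and \<open>u \<otimes> x\<close> is the commutator of \<open>u\<close>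
    and \<open>n\<close>.\<close>
  define x where "x = n \<otimes> inv u \<otimes> inv n"
  have xc: "x \<in> carrier G" using c by (simp add: x_def)
  have "x \<in> conjugate G n A"
    unfolding x_def using A(1) uv by (intro mem_conjugate subgroup.m_inv_closed)
  then have xv: "x \<otimes> v = v \<otimes> x"
    using elementwise_commutingD[OF A(2) uv(2)] by simp
  have "u \<otimes> x = u \<otimes> n \<otimes> inv u \<otimes> inv n"
    using c by (simp add: x_def group_normalize)
  then have ux: "u \<otimes> x \<in> N"
    using subgroup.m_closed[OF N norm(1)[OF n] subgroup.m_inv_closed[OF N n]] by simp
  have "(u \<otimes> x) \<otimes> (v \<otimes> inv (u \<otimes> x) \<otimes> inv v) \<in> N"
    using ux norm(2)[OF subgroup.m_inv_closed[OF N ux]] by (rule subgroup.m_closed[OF N])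
  moreover have "(u \<otimes> x) \<otimes> (v \<otimes> inv (u \<otimes> x) \<otimes> inv v) = commutator (u \<otimes> x) v"
    using c xc by (simp add: m_assoc)
  ultimately show ?thesis
    using commutator_mult_commuting_left[OF c(1,2) xc xv] by simp
qed

lemma not_comm_groupE:
  assumes "subgroup A G" "\<not> comm_group (G\<lparr>carrier := A\<rparr>)"
  obtains a b where "a \<in> A" "b \<in> A" "a \<otimes> b \<noteq> b \<otimes> a"
proof -
  have "group (G\<lparr>carrier := A\<rparr>)"
    using assms(1) by (rule subgroup_imp_group)
  then show thesis
    using assms(2) that group.group_comm_groupI[of "G\<lparr>carrier := A\<rparr>"] by auto
qed

lemma normal_restrictD:
  assumes M: "subgroup M G" and N: "N \<lhd> G\<lparr>carrier := M\<rparr>"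
  shows "subgroup N G" "N \<subseteq> M" "\<And>m x. \<lbrakk>m \<in> M; x \<in> N\<rbrakk> \<Longrightarrow> m \<otimes> x \<otimes> inv m \<in> N"
proof -
  interpret M: group "G\<lparr>carrier := M\<rparr>" using M by (rule subgroup_imp_group)
  have sub: "subgroup N (G\<lparr>carrier := M\<rparr>)" using N by (rule M.normal_invE(1))
  then show "subgroup N G" using M incl_subgroup by blast
  show "N \<subseteq> M" using subgroup.subset[OF sub] by simp
  show "m \<otimes> x \<otimes> inv m \<in> N" if "m \<in> M" "x \<in> N" for m x
    using M.normal_invE(2)[OF N, of m x] that M by (simp add: m_inv_consistent)
qed

end

section \<open>Joinable compression families\<close>

locale joinable_compression = group G for G (structure) +
  fixes \<C> :: "'a set set"
  assumes nontrivial: "carrier G \<noteq> {\<one>}"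
    and family: "joinable_compression_family G \<C> (carrier G)"
begin

lemma family_subgroup: "A \<in> \<C> \<Longrightarrow> subgroup A G"
  and family_conjugate: "\<lbrakk>A \<in> \<C>; g \<in> carrier G\<rbrakk> \<Longrightarrow> conjugate G g A \<in> \<C>"
  using family
  by (auto simp: joinable_compression_family_def conjugation_invariant_family_def)

lemma family_carrier: "A \<in> \<C> \<Longrightarrow> A \<subseteq> carrier G"
  by (simp add: family_subgroup subgroup.subset)

lemma family_nonabelian:
  assumes "A \<in> \<C>"
  obtains a b where "a \<in> A" "b \<in> A" "a \<otimes> b \<noteq> b \<otimes> a"
  using assms family not_comm_groupE[OF family_subgroup[OF assms]]
  by (auto simp: joinable_compression_family_def all_nonabelian_def)

lemma family_semi_transitive: "semi_transitive G \<C> (carrier G)"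
  using family by (simp add: joinable_compression_family_def)

lemma family_displaced:
  assumes "g \<in> carrier G" "g \<noteq> \<one>"
  obtains A where "A \<in> \<C>" "elementwise_commuting G A (conjugate G g A)"
proof -
  obtain A where A: "A \<in> \<C>" "commutator_subgroup G A (conjugate G g A) = {\<one>}"
    using family assms by (auto simp: joinable_compression_family_def displaceable_def)
  then have "elementwise_commuting G A (conjugate G g A)"
    using assms by (intro elementwise_commutingI family_carrier family_conjugate)
  with A(1) show thesis by (rule that)
qed

lemma family_joinable:
  assumes "A \<in> \<C>" "B \<in> \<C>" "C \<in> \<C>" "elementwise_commuting G A C" "\<not> C \<subseteq> B"
  obtains D where "D \<in> \<C>" "A \<subseteq> D" "B \<subseteq> D"
proof -
  have "commutator_subgroup G A C = {\<one>}"
    using assms by (intro commutator_subgroup_trivial family_carrier)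
  then obtain D where D: "D \<in> \<C>" "generate G (A \<union> B) \<subseteq> D"
    using family assms unfolding joinable_compression_family_def joinable_def by blast
  have "A \<union> B \<subseteq> generate G (A \<union> B)"
    by (auto intro: generate.incl)
  with D show thesis
    using that by blast
qed

text \<open>Some member \<open>A\<close> is displaced by \<open>g\<close>. Compress \<open>B\<close>
  into \<open>A\<close> by an element \<open>h\<close> of \<open>K\<close> and pull the commuting
  pair back along \<open>h\<close>: a conjugate of \<open>g\<close> displaces \<open>B\<close>
  itself.\<close>

lemma displace_member:
  assumes K: "subgroup K G" "semi_transitive G \<C> K" and g: "g \<in> K" "g \<noteq> \<one>" and B: "B \<in> \<C>"
  obtains h where "h \<in> K" "elementwise_commuting G B (conjugate G (inv h \<otimes> g \<otimes> h) B)"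
proof -
  have gc: "g \<in> carrier G" using g(1) K(1) by (rule subgroup.mem_carrier[rotated])
  obtain A where A: "A \<in> \<C>" "elementwise_commuting G A (conjugate G g A)"
    using family_displaced[OF gc g(2)] .
  obtain h where h: "h \<in> K" "conjugate G h B \<subseteq> A"
    using K(2) A(1) B unfolding semi_transitive_def by blast
  have hc: "h \<in> carrier G" using h(1) K(1) by (rule subgroup.mem_carrier[rotated])
  let ?hB = "conjugate G h B"
  have c: "B \<subseteq> carrier G" "?hB \<subseteq> carrier G" "conjugate G g ?hB \<subseteq> carrier G"
    using B hc gc by (auto dest!: family_carrier[OF family_conjugate, rotated -1]
        simp: family_carrier family_conjugate)
  have "elementwise_commuting G ?hB (conjugate G g ?hB)"
    using A(2) h(2) by (intro elementwise_commuting_mono[OF A(2)] conjugate_mono)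
  then have "elementwise_commuting G (conjugate G (inv h) ?hB)
      (conjugate G (inv h) (conjugate G g ?hB))"
    using hc c by (intro elementwise_commuting_conjugate) auto
  moreover have "conjugate G (inv h) ?hB = B"
    using hc c(1) by (simp add: conjugate_mult[symmetric] conjugate_one)
  moreover have "conjugate G (inv h) (conjugate G g ?hB) = conjugate G (inv h \<otimes> g \<otimes> h) B"
    using hc gc c by (simp add: conjugate_mult)
  ultimately show thesis
    using that h(1) by simp
qed

section \<open>Non-trivial normal subgroups and the monolith\<close>

text \<open>A suitable conjugate of a non-trivial element of \<open>N\<close> displaces
  \<open>A\<close> and still lies in \<open>N\<close>. It is returned as \<open>n\<close> because
  the join argument also uses the member \<open>n A n\<inverse>\<close>.\<close>

lemma commutators_mem_normal:
  assumes N: "N \<lhd> G" "N \<noteq> {\<one>}" and A: "A \<in> \<C>"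
  obtains n where "n \<in> N" "elementwise_commuting G A (conjugate G n A)"
    "\<And>a b. \<lbrakk>a \<in> A; b \<in> A\<rbrakk> \<Longrightarrow> commutator a b \<in> N"
proof -
  interpret N: normal N G by (fact N(1))
  obtain m where m: "m \<in> N" "m \<noteq> \<one>" using N(2) N.one_closed by blast
  obtain h where h: "h \<in> carrier G" "elementwise_commuting G A (conjugate G (inv h \<otimes> m \<otimes> h) A)"
    using displace_member[OF subgroup_self family_semi_transitive N.mem_carrier[OF m(1)] m(2) A] .
  have n: "inv h \<otimes> m \<otimes> h \<in> N" using m h(1) by (simp add: N.inv_op_closed1)
  have "commutator a b \<in> N" if "a \<in> A" "b \<in> A" for a b
    using that A family_carrier
    by (intro commutator_mem_if_displaced[OF N.is_subgroup n family_subgroup[OF A] h(2)]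
        N.inv_op_closed2) auto
  with n h(2) show thesis by (rule that)
qed

lemma derived_generate_incl_normal:
  assumes N: "N \<lhd> G" "N \<noteq> {\<one>}"
  shows "derived G (generate G (\<Union>\<C>)) \<subseteq> N"
proof (rule derived_generate_incl[OF N(1)])
  interpret N: normal N G by (fact N(1))
  show "\<Union>\<C> \<subseteq> carrier G" using family_carrier by blast
  fix a b assume "a \<in> \<Union>\<C>" "b \<in> \<Union>\<C>"
  then obtain A B where A: "A \<in> \<C>" "a \<in> A" and B: "B \<in> \<C>" "b \<in> B" by blast
  have c: "a \<in> carrier G" "b \<in> carrier G" using A B family_carrier by auto
  obtain n where n: "n \<in> N" "elementwise_commuting G A (conjugate G n A)"
    using commutators_mem_normal[OF N A(1)] by metis
  let ?C = "conjugate G n A"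
  have C: "?C \<in> \<C>" using A n by (intro family_conjugate) auto
  show "commutator a b \<in> N"
  proof (cases "?C \<subseteq> B")
    case False
    obtain D where D: "D \<in> \<C>" "A \<subseteq> D" "B \<subseteq> D"
      using family_joinable[OF A(1) B(1) C n(2) False] .
    then show ?thesis
      using commutators_mem_normal[OF N D(1)] A B by (metis subsetD)
  next
    case True
    have nc: "n \<in> carrier G" using n(1) by (rule N.mem_carrier)
    \<comment> \<open>\<open>x\<close> is congruent to \<open>a\<close> modulo \<open>N\<close> but
      lies in \<open>B\<close>, where commutators are already known to be in \<open>N\<close>; the
      factor \<open>w\<close> below measures the difference.\<close>
    define x where "x = n \<otimes> a \<otimes> inv n"
    have xB: "x \<in> B" using True A mem_conjugate[of a A G n] by (auto simp: x_def)
    have xc: "x \<in> carrier G" using nc c by (simp add: x_def)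
    have xb: "commutator x b \<in> N"
      using commutators_mem_normal[OF N B(1)] xB B by metis
    define w where "w = a \<otimes> inv x"
    have wc: "w \<in> carrier G" using c xc by (simp add: w_def)
    have "w = (a \<otimes> n \<otimes> inv a) \<otimes> inv n"
      using nc c by (simp add: w_def x_def group_normalize)
    then have w: "w \<in> N" using n c by (simp add: N.inv_op_closed2)
    \<comment> \<open>Replacing \<open>x\<close> by \<open>w \<otimes> x = a\<close> changes the
      commutator with \<open>b\<close> only by the factors \<open>w\<close> and
      \<open>b \<otimes> inv w \<otimes> inv b\<close>, both in \<open>N\<close>.\<close>
    have "w \<otimes> commutator x b \<otimes> (b \<otimes> inv w \<otimes> inv b) \<in> N"
      using N.m_closed[OF N.m_closed[OF w xb] N.inv_op_closed2[OF c(2) N.m_inv_closed[OF w]]] .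
    moreover have "w \<otimes> commutator x b \<otimes> (b \<otimes> inv w \<otimes> inv b) = commutator (w \<otimes> x) b"
      using wc xc c by (simp add: group_normalize)
    moreover have "w \<otimes> x = a" using c xc by (simp add: w_def group_normalize)
    ultimately show ?thesis by simp
  qed
qed

lemma generate_family_normal: "generate G (\<Union>\<C>) \<lhd> G"
proof (rule normal_generateI)
  show "\<Union>\<C> \<subseteq> carrier G" using family_carrier by blast
  fix h g assume "h \<in> \<Union>\<C>" and g: "g \<in> carrier G"
  then obtain A where A: "A \<in> \<C>" "h \<in> A" by blast
  show "g \<otimes> h \<otimes> inv g \<in> \<Union>\<C>"
    using family_conjugate[OF A(1) g] mem_conjugate[OF A(2)] by (rule UnionI)
qed

lemma member_subset_generate: "A \<in> \<C> \<Longrightarrow> A \<subseteq> generate G (\<Union>\<C>)"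
  by (auto intro: generate.incl)

lemma family_nonempty: obtains A where "A \<in> \<C>"
proof -
  obtain g where "g \<in> carrier G" "g \<noteq> \<one>" using nontrivial one_closed by blast
  then show thesis using family_displaced that by blast
qed

lemma derived_nontrivial:
  assumes "\<And>A. A \<in> \<C> \<Longrightarrow> A \<subseteq> K"
  shows "derived G K \<noteq> {\<one>}"
proof -
  obtain A where A: "A \<in> \<C>" by (rule family_nonempty)
  obtain a b where ab: "a \<in> A" "b \<in> A" "a \<otimes> b \<noteq> b \<otimes> a" using A by (rule family_nonabelian)
  have "commutator a b \<in> derived G K" using ab A assms by (intro commutator_mem_derived) auto
  moreover have "commutator a b \<noteq> \<one>"
    using ab A family_carrier by (simp add: commutator_eq_one_iff subset_iff)
  ultimately show ?thesis by blast
qed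

text \<open>The derived subgroup lies in every non-trivial normal subgroup and is one of them
  itself, so it is the intersection.\<close>

lemma derived_eq_monolith: "derived G (generate G (\<Union>\<C>)) = monolith G"
proof
  have norm: "derived G (generate G (\<Union>\<C>)) \<lhd> G"
    using generate_family_normal by (rule derived_is_normal)
  show "derived G (generate G (\<Union>\<C>)) \<subseteq> monolith G"
    using normal_imp_subgroup[OF norm] derived_generate_incl_normal
    by (auto simp: monolith_def dest: subgroup.mem_carrier)
  show "monolith G \<subseteq> derived G (generate G (\<Union>\<C>))"
    using norm derived_nontrivial[OF member_subset_generate] by (auto simp: monolith_def)
qed

section \<open>Commuting conjugates inside a member\<close>

text \<open>A member \<open>C\<close> commuting with \<open>A\<close>, hence centralised by \<open>n\<close>, cannot lie in \<open>B\<close>: it would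
  commute with \<open>n C n\<inverse> = C\<close>.\<close>

lemma join_displaced:
  assumes A: "A \<in> \<C>" and n: "n \<in> A" "n \<noteq> \<one>"
    and B: "B \<in> \<C>" "elementwise_commuting G B (conjugate G n B)"
  obtains D where "D \<in> \<C>" "A \<subseteq> D" "B \<subseteq> D"
proof -
  have nc: "n \<in> carrier G" using n A family_carrier by blast
  obtain h where h: "h \<in> carrier G" "elementwise_commuting G A (conjugate G (inv h \<otimes> n \<otimes> h) A)"
    using displace_member[OF subgroup_self family_semi_transitive nc n(2) A] .
  let ?C = "conjugate G (inv h \<otimes> n \<otimes> h) A"
  have C: "?C \<in> \<C>" using A h nc by (intro family_conjugate) auto
  have "\<not> ?C \<subseteq> B"
  proof
    assume sub: "?C \<subseteq> B"
    obtain x y where xy: "x \<in> ?C" "y \<in> ?C" "x \<otimes> y \<noteq> y \<otimes> x" using C by (rule family_nonabelian)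
    have "y \<in> carrier G" using xy C family_carrier by blast
    then have "n \<otimes> y \<otimes> inv n = y"
      using nc elementwise_commutingD[OF h(2) n(1) xy(2)] by (intro commuting_conj_eq)
    then have "y \<in> conjugate G n B"
      using mem_conjugate[of y B G n] sub xy by auto
    then show False
      using elementwise_commutingD[OF B(2)] sub xy by blast
  qed
  then show thesis
    using family_joinable[OF A B(1) C h(2)] that by blast
qed

text \<open>A non-trivial \<open>a\<close> in \<open>A\<close> displaces some member
  \<open>B\<close>, but \<open>B\<close> need not lie in \<open>A\<close>. Join \<open>A\<close> and
  \<open>B\<close> inside \<open>D\<close>, compress \<open>D\<close> into \<open>A\<close> by
  \<open>t\<close>, and take the \<open>t\<close>-conjugates of \<open>B\<close> and
  \<open>a\<close> as \<open>E\<close> and \<open>k\<close>.\<close>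

lemma commuting_conjugates_within:
  assumes A: "A \<in> \<C>"
  obtains E k where "E \<in> \<C>" "E \<subseteq> A" "k \<in> A" "elementwise_commuting G E (conjugate G k E)"
proof -
  have Ac: "A \<subseteq> carrier G" using A by (rule family_carrier)
  obtain a b where ab: "a \<in> A" "b \<in> A" "a \<otimes> b \<noteq> b \<otimes> a" using A by (rule family_nonabelian)
  have n: "a \<in> carrier G" "a \<noteq> \<one>" using ab Ac by auto
  obtain B where B: "B \<in> \<C>" "elementwise_commuting G B (conjugate G a B)"
    using family_displaced[OF n] .
  obtain D where D: "D \<in> \<C>" "A \<subseteq> D" "B \<subseteq> D"
    using join_displaced[OF A ab(1) n(2) B] .
  obtain t where t: "t \<in> carrier G" "conjugate G t D \<subseteq> A"
    using family_semi_transitive A D unfolding semi_transitive_def by blast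
  let ?E = "conjugate G t B" and ?k = "t \<otimes> a \<otimes> inv t"
  have Bc: "B \<subseteq> carrier G" "conjugate G a B \<subseteq> carrier G"
    using B n by (auto intro!: family_carrier family_conjugate simp del: subsetI)
  have "conjugate G ?k ?E = conjugate G (?k \<otimes> t) B"
    using t n Bc by (simp add: conjugate_mult)
  also have "?k \<otimes> t = t \<otimes> a" using t n by (simp add: group_normalize)
  also have "conjugate G (t \<otimes> a) B = conjugate G t (conjugate G a B)"
    using t n Bc by (simp add: conjugate_mult)
  finally have "elementwise_commuting G ?E (conjugate G ?k ?E)"
    using elementwise_commuting_conjugate[OF t(1) Bc B(2)] by simp
  moreover have "?k \<in> A" using mem_conjugate[of a D G t] t ab D by blast
  moreover have "?E \<subseteq> A" using conjugate_mono[OF D(3), of G t] t by blast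
  moreover have "?E \<in> \<C>" using B t by (intro family_conjugate)
  ultimately show thesis using that by blast
qed

text \<open>Two nested applications of \<open>commuting_conjugates_within\<close> give
  \<open>F \<subseteq> E \<subseteq> A\<close> with \<open>k\<close> in \<open>A\<close> and
  \<open>l\<close> in \<open>E\<close>. As \<open>l\<close> lies in \<open>E\<close>, the conjugate
  \<open>l F l\<inverse>\<close> stays in \<open>E\<close> and so commutes with
  \<open>k E k\<inverse>\<close>.\<close>

lemma exists_member_commutators_mem:
  assumes N: "subgroup N G" "N \<noteq> {\<one>}"
    and norm: "\<And>m x. \<lbrakk>m \<in> derived G (generate G (\<Union>\<C>)); x \<in> N\<rbrakk> \<Longrightarrow> m \<otimes> x \<otimes> inv m \<in> N"
  obtains F where "F \<in> \<C>" "\<And>a b. \<lbrakk>a \<in> F; b \<in> F\<rbrakk> \<Longrightarrow> commutator a b \<in> N"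
proof -
  obtain n where n: "n \<in> N" "n \<noteq> \<one>" using N subgroup.one_closed by blast
  have nc: "n \<in> carrier G" using N(1) n(1) by (rule subgroup.mem_carrier)
  obtain A where A: "A \<in> \<C>" "elementwise_commuting G A (conjugate G n A)"
    using family_displaced[OF nc n(2)] .
  obtain E k where E: "E \<in> \<C>" "E \<subseteq> A" and k: "k \<in> A" "elementwise_commuting G E (conjugate G k E)"
    using commuting_conjugates_within[OF A(1)] .
  obtain F l where F: "F \<in> \<C>" "F \<subseteq> E" and l: "l \<in> E" "elementwise_commuting G F (conjugate G l F)"
    using commuting_conjugates_within[OF E(1)] .
  interpret A: subgroup A G using A(1) by (rule family_subgroup)
  interpret E: subgroup E G using E(1) by (rule family_subgroup)
  interpret F: subgroup F G using F(1) by (rule family_subgroup)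
  have "commutator a b \<in> N" if ab: "a \<in> F" "b \<in> F" for a b
  proof -
    let ?x = "k \<otimes> inv a \<otimes> inv k" and ?y = "l \<otimes> inv b \<otimes> inv l"
    have aA: "a \<in> A" and bA: "b \<in> A" and lA: "l \<in> A" and bE: "b \<in> E"
      using ab F E l by auto
    have c: "a \<in> carrier G" "b \<in> carrier G" "?x \<in> carrier G" "?y \<in> carrier G"
      using aA bA lA k(1) by auto
    have x: "?x \<in> conjugate G k E" using ab F by (intro mem_conjugate) auto
    have y: "?y \<in> conjugate G l F" using ab by (intro mem_conjugate) auto
    have yE: "?y \<in> E" using bE l(1) by auto
    have eq: "a \<otimes> ?x = commutator a k" "b \<otimes> ?y = commutator b l"
      using aA bA lA k(1) by (auto simp: group_normalize)
    have mem: "a \<otimes> ?x \<in> A" "b \<otimes> ?y \<in> A" using aA bA lA k(1) by auto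
    have "commutator a k \<in> derived G (generate G (\<Union>\<C>))"
      "commutator b l \<in> derived G (generate G (\<Union>\<C>))"
      using aA bA lA k(1) member_subset_generate[OF A(1)]
      by (auto intro!: commutator_mem_derived)
    \<comment> \<open>Both arguments are commutators: they lie in \<open>A\<close>, which
      \<open>n\<close> displaces, and in the derived subgroup, which normalises
      \<open>N\<close>.\<close>
    then have "commutator (a \<otimes> ?x) (b \<otimes> ?y) \<in> N"
      using norm eq
      by (intro commutator_mem_if_displaced[OF N(1) n(1) A.subgroup_axioms A(2) mem]) simp_all
    \<comment> \<open>\<open>b\<close> and \<open>?y\<close> both lie in \<open>E\<close>, so
      \<open>?x\<close> commutes with their product and drops out; then \<open>?y\<close> drops out
      because it commutes with \<open>a\<close>.\<close>
    moreover have xby: "?x \<otimes> (b \<otimes> ?y) = (b \<otimes> ?y) \<otimes> ?x"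
      using elementwise_commutingD[OF k(2) bE x, symmetric]
        elementwise_commutingD[OF k(2) yE x, symmetric]
      by (rule commuting_mult_right[OF c(3,2,4)])
    ultimately have "commutator a (b \<otimes> ?y) \<in> N"
      by (simp only: commutator_mult_commuting_left[OF c(1) m_closed[OF c(2,4)] c(3) xby])
    then show ?thesis
      by (simp only: commutator_mult_commuting_right[OF c(1,2,4)
            elementwise_commutingD[OF l(2) ab(1) y, symmetric]])
  qed
  with F(1) show thesis by (rule that)
qed

section \<open>Simplicity of the derived subgroup\<close>

text \<open>An element \<open>a\<close> of a member \<open>A\<close> acts on \<open>B\<close> like \<open>[a, k]\<close> if \<open>k A k\<inverse>\<close> commutes with
  \<open>B\<close>.\<close>

lemma conjugate_by_derived:
  assumes trans: "semi_transitive G \<C> (generate G (\<Union>\<C>))"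
    and "h \<in> generate G (\<Union>\<C>)" "B \<in> \<C>"
  shows "\<exists>m \<in> derived G (generate G (\<Union>\<C>)). conjugate G m B = conjugate G h B"
  using assms(2,3)
\<comment> \<open>\<open>B\<close> stays arbitrary because, for a product, the first factor acts on
  the conjugate of \<open>B\<close> by the second.\<close>
proof (induction h arbitrary: B rule: generate.induct)
  let ?H = "generate G (\<Union>\<C>)"
  interpret H: normal ?H G by (rule generate_family_normal)
  have single: "\<exists>m \<in> derived G ?H. conjugate G m B = conjugate G a B"
    if A: "A \<in> \<C>" "a \<in> A" and B: "B \<in> \<C>" for a A B
  proof -
    have Ac: "A \<subseteq> carrier G" and Bc: "B \<subseteq> carrier G" using A B family_carrier by auto
    have ac: "a \<in> carrier G" using A Ac by blast
    obtain x y where xy: "x \<in> A" "y \<in> A" "x \<otimes> y \<noteq> y \<otimes> x" using A(1) by (rule family_nonabelian)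
    have g: "x \<in> ?H" "x \<noteq> \<one>" using xy A(1) Ac member_subset_generate by auto
    obtain h where h: "h \<in> ?H" "elementwise_commuting G B (conjugate G (inv h \<otimes> x \<otimes> h) B)"
      using displace_member[OF H.is_subgroup trans g B] .
    obtain t where t: "t \<in> ?H" "conjugate G t A \<subseteq> B"
      using trans A(1) B unfolding semi_transitive_def by blast
    define s where "s = inv h \<otimes> x \<otimes> h"
    \<comment> \<open>\<open>t\<close> compresses \<open>A\<close> into \<open>B\<close> and
      \<open>s\<close> displaces \<open>B\<close>, so \<open>k\<close> carries \<open>A\<close> into
      a conjugate of \<open>B\<close> that commutes with \<open>B\<close>.\<close>
    define k where "k = s \<otimes> t"
    have sH: "s \<in> ?H" unfolding s_def using h(1) g(1) by auto
    then have kH: "k \<in> ?H" unfolding k_def using t(1) by blast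
    have c: "s \<in> carrier G" "t \<in> carrier G" "k \<in> carrier G"
      using sH kH t(1) by (auto intro: H.mem_carrier)
    have "conjugate G k A \<subseteq> conjugate G s B"
      unfolding k_def using conjugate_mono[OF t(2), of G s] c Ac by (simp add: conjugate_mult)
    then have comm: "elementwise_commuting G B (conjugate G k A)"
      using h(2) unfolding s_def by (intro elementwise_commuting_mono[OF h(2)]) auto
    let ?z = "k \<otimes> inv a \<otimes> inv k"
    have zc: "?z \<in> carrier G" using c ac by simp
    have z: "?z \<in> conjugate G k A"
      using A by (intro mem_conjugate subgroup.m_inv_closed family_subgroup)
    \<comment> \<open>\<open>?z\<close> lies in \<open>k A k\<inverse>\<close> and centralises
      \<open>B\<close>, so \<open>a\<close> can be replaced by \<open>a \<otimes> ?z\<close>, the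
      commutator of \<open>a\<close> and \<open>k\<close>.\<close>
    have "?z \<otimes> b \<otimes> inv ?z = b" if "b \<in> B" for b
      using that Bc zc elementwise_commutingD[OF comm that z] by (intro commuting_conj_eq) auto
    then have "conjugate G ?z B = B" by (simp add: conjugate_eq_image)
    then have "conjugate G (a \<otimes> ?z) B = conjugate G a B"
      using conjugate_mult[OF ac zc Bc] by simp
    moreover have "a \<otimes> ?z = commutator a k" using ac c by (simp add: group_normalize)
    moreover have "commutator a k \<in> derived G ?H"
      using A kH member_subset_generate by (intro commutator_mem_derived) auto
    ultimately show ?thesis by auto
  qed
  {
    case one
    then show ?case
      using generate.one[of G "derived_set G ?H"] by (auto simp: derived_def)
  next
    case (incl h)
    then show ?case using single by blast
  next
    case (inv h)
    then show ?case using single family_subgroup subgroup.m_inv_closed by (metis UnionE)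
  next
    case (eng h1 h2)
    have sub: "subgroup (derived G ?H) G" using H.subset by (rule derived_is_subgroup)
    have c: "h1 \<in> carrier G" "h2 \<in> carrier G" using eng.hyps H.mem_carrier by auto
    obtain m2 where m2: "m2 \<in> derived G ?H" "conjugate G m2 B = conjugate G h2 B"
      using eng.IH(2) eng.prems by blast
    have "conjugate G h2 B \<in> \<C>" using eng.prems c by (intro family_conjugate)
    then obtain m1 where m1: "m1 \<in> derived G ?H"
      "conjugate G m1 (conjugate G h2 B) = conjugate G h1 (conjugate G h2 B)"
      using eng.IH(1) by blast
    have "conjugate G (m1 \<otimes> m2) B = conjugate G (h1 \<otimes> h2) B"
      using m1 m2 c family_carrier[OF eng.prems] subgroup.mem_carrier[OF sub]
      by (simp add: conjugate_mult)
    then show ?case using subgroup.m_closed[OF sub m1(1) m2(1)] by blast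
  }
qed

text \<open>Semi-transitivity compresses \<open>A\<close> into the member \<open>F\<close> whose
  commutators lie in \<open>N\<close>. The compressing element can be taken in the derived subgroup,
  which normalises \<open>N\<close>, so commutators in \<open>A\<close> are recovered by conjugating
  back.\<close>

lemma commutators_mem_if_normal_in_derived:
  assumes trans: "semi_transitive G \<C> (generate G (\<Union>\<C>))"
    and N: "subgroup N G" "N \<noteq> {\<one>}"
    and norm: "\<And>m x. \<lbrakk>m \<in> derived G (generate G (\<Union>\<C>)); x \<in> N\<rbrakk> \<Longrightarrow> m \<otimes> x \<otimes> inv m \<in> N"
    and A: "A \<in> \<C>" and ab: "a \<in> A" "b \<in> A"
  shows "commutator a b \<in> N"
proof -
  let ?M = "derived G (generate G (\<Union>\<C>))"
  have M: "subgroup ?M G"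
    using generate_family_normal derived_is_normal normal_imp_subgroup by blast
  obtain F where F: "F \<in> \<C>" "\<And>a b. \<lbrakk>a \<in> F; b \<in> F\<rbrakk> \<Longrightarrow> commutator a b \<in> N"
    using exists_member_commutators_mem[OF N norm] by metis
  obtain h where h: "h \<in> generate G (\<Union>\<C>)" "conjugate G h A \<subseteq> F"
    using trans A F(1) unfolding semi_transitive_def by blast
  obtain m where m: "m \<in> ?M" "conjugate G m A \<subseteq> F"
    using conjugate_by_derived[OF trans h(1) A] h(2) by auto
  have c: "a \<in> carrier G" "b \<in> carrier G" "m \<in> carrier G"
    using ab A family_carrier subgroup.mem_carrier[OF M m(1)] by auto
  have "commutator (m \<otimes> a \<otimes> inv m) (m \<otimes> b \<otimes> inv m) \<in> N"
    using F(2) m(2) ab mem_conjugate[of _ A G m] by blast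
  then have "inv m \<otimes> commutator (m \<otimes> a \<otimes> inv m) (m \<otimes> b \<otimes> inv m) \<otimes> inv (inv m) \<in> N"
    using M m(1) by (intro norm subgroup.m_inv_closed)
  then show ?thesis
    using c by (simp add: group_normalize)
qed

lemma derived_simple:
  assumes trans: "semi_transitive G \<C> (generate G (\<Union>\<C>))"
  shows "is_simple (G\<lparr>carrier := derived G (generate G (\<Union>\<C>))\<rparr>)"
proof -
  let ?M = "derived G (generate G (\<Union>\<C>))"
  have M: "subgroup ?M G"
    using generate_family_normal derived_is_normal normal_imp_subgroup by blast
  have "N = ?M" if N: "N \<lhd> G\<lparr>carrier := ?M\<rparr>" "N \<noteq> {\<one>}" for N
  proof
    note ND = normal_restrictD[OF M N(1)]
    show "N \<subseteq> ?M" by (rule ND(2))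
    \<comment> \<open>\<open>N\<close> is not known to be normal in \<open>G\<close>, but this union
      is invariant under conjugation in \<open>G\<close> and will turn out to lie in
      \<open>N\<close>; the subgroup it generates mediates between \<open>?M\<close> and
      \<open>N\<close>.\<close>
    let ?S = "\<Union>A\<in>\<C>. derived G A"
    have "generate G ?S \<lhd> G"
    proof (rule normal_generateI)
      show "?S \<subseteq> carrier G" using derived_in_carrier family_carrier by blast
      fix x g assume x: "x \<in> ?S" and g: "g \<in> carrier G"
      then obtain A where A: "A \<in> \<C>" "x \<in> derived G A" by blast
      \<comment> \<open>As an endomorphism, conjugation by \<open>g\<close> carries the derived
        subgroup of \<open>A\<close> onto that of the conjugate of \<open>A\<close>.\<close>
      interpret gh: group_hom G G "\<lambda>x. g \<otimes> x \<otimes> inv g"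
        using g by unfold_locales (auto simp: hom_def group_normalize)
      have "g \<otimes> x \<otimes> inv g \<in> derived G (conjugate G g A)"
        using A gh.derived_img[OF family_carrier[OF A(1)]] by (auto simp: conjugate_eq_image)
      then show "g \<otimes> x \<otimes> inv g \<in> ?S" using A(1) g family_conjugate by blast
    qed
    moreover have "generate G ?S \<noteq> {\<one>}"
    proof -
      obtain A where A: "A \<in> \<C>" by (rule family_nonempty)
      obtain a b where ab: "a \<in> A" "b \<in> A" "a \<otimes> b \<noteq> b \<otimes> a"
        using A by (rule family_nonabelian)
      have "commutator a b \<in> generate G ?S"
        using A ab commutator_mem_derived by (intro generate.incl) blast
      moreover have "commutator a b \<noteq> \<one>"
        using ab A family_carrier by (simp add: commutator_eq_one_iff subset_iff)
      ultimately show ?thesis by blast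
    qed
    ultimately have "?M \<subseteq> generate G ?S" by (rule derived_generate_incl_normal)
    also have "\<dots> \<subseteq> N"
    proof (rule generate_subgroup_incl[OF _ ND(1)])
      have "derived G A \<subseteq> N" if "A \<in> \<C>" for A
        unfolding derived_def
        using commutators_mem_if_normal_in_derived[OF trans ND(1) N(2) ND(3) that]
        by (intro generate_subgroup_incl[OF _ ND(1)]) blast
      then show "?S \<subseteq> N" by blast
    qed
    finally show "?M \<subseteq> N" .
  qed
  then show ?thesis
    using subgroup_imp_group[OF M] derived_nontrivial[OF member_subset_generate]
    by (auto simp: is_simple_def)
qed

section \<open>Perfectness under the shift condition\<close>

text \<open>If \<open>x\<close> is the image of the constant sequence \<open>a, a, \<dots>\<close>, then \<open>x = a (g x g\<inverse>)\<close>, so that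
  \<open>a = [x, g]\<close>.\<close>

lemma derived_eq_if_shiftable:
  assumes shift: "shiftable G \<C> (generate G (\<Union>\<C>))"
  shows "derived G (generate G (\<Union>\<C>)) = generate G (\<Union>\<C>)"
proof
  let ?H = "generate G (\<Union>\<C>)"
  interpret H: normal ?H G by (rule generate_family_normal)
  show "derived G ?H \<subseteq> ?H" by (intro derived_incl H.is_subgroup) simp
  have "a \<in> derived G ?H" if A: "A \<in> \<C>" "a \<in> A" for a A
  proof -
    let ?P = "product_group (UNIV :: nat set) (\<lambda>_. G\<lparr>carrier := A\<rparr>)"
    obtain g \<phi> where g: "g \<in> ?H" and \<phi>: "\<phi> \<in> hom ?P (G\<lparr>carrier := ?H\<rparr>)"
      and first: "\<forall>a\<in>A. \<phi> (case_nat a (\<lambda>_. \<one>)) = a"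
      and step: "\<forall>x\<in>carrier ?P. g \<otimes> \<phi> x \<otimes> inv g = \<phi> (case_nat \<one> x)"
      using bspec[OF shift[unfolded shiftable_def] A(1)]
      by (elim bexE conjE) (rule that; assumption)
    interpret A: subgroup A G using A(1) by (rule family_subgroup)
    let ?f = "\<lambda>_ :: nat. a"
    have mem: "?f \<in> carrier ?P" "case_nat a (\<lambda>_. \<one>) \<in> carrier ?P" "case_nat \<one> ?f \<in> carrier ?P"
      using A(2) by (auto simp: PiE_iff split: nat.split)
    define x where "x = \<phi> ?f"
    have x: "x \<in> ?H" using hom_in_carrier[OF \<phi> mem(1)] by (simp add: x_def)
    have c: "x \<in> carrier G" "g \<in> carrier G" "a \<in> carrier G"
      using x g A by auto
    \<comment> \<open>The constant sequence splits into its first entry and its own shift; applying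
      \<open>\<phi>\<close> turns the shift into conjugation by \<open>g\<close>.\<close>
    have "case_nat a (\<lambda>_. \<one>) \<otimes>\<^bsub>?P\<^esub> case_nat \<one> ?f = ?f"
      using A(2) by (auto simp: fun_eq_iff split: nat.split)
    then have "x = a \<otimes> (g \<otimes> x \<otimes> inv g)"
      using hom_mult[OF \<phi> mem(2,3)] bspec[OF first A(2)] bspec[OF step mem(1)] by (simp add: x_def)
    then have "x \<otimes> inv (g \<otimes> x \<otimes> inv g) = a"
      using c by (metis inv_closed inv_solve_right m_closed)
    then have "a = commutator x g"
      using c by (simp add: group_normalize)
    then show ?thesis using x g commutator_mem_derived by simp
  qed
  then show "?H \<subseteq> derived G ?H"
    by (intro generate_subgroup_incl derived_is_subgroup H.subset) blast
qed

end

theorem theorem1p6: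
  fixes G :: "('a, 'b) monoid_scheme" and \<C> :: "'a set set" and H :: "'a set"
  assumes "group G" and "carrier G \<noteq> {\<one>\<^bsub>G\<^esub>}"
    and "joinable_compression_family G \<C> (carrier G)"
    and "H = generate G (\<Union>\<C>)"
  shows "derived G H = monolith G \<and>
         (semi_transitive G \<C> H \<longrightarrow> is_simple (G\<lparr>carrier := derived G H\<rparr>)) \<and>
         (shift_joinable_compression_family G \<C> H \<longrightarrow>
            derived G H = H \<and> H = monolith G \<and> is_simple (G\<lparr>carrier := H\<rparr>))"
proof -
  interpret joinable_compression G \<C>
    using assms(1-3) by (simp add: joinable_compression_def joinable_compression_axioms_def)
  \<comment> \<open>The shift condition identifies \<open>H\<close> with its derived subgroup, so
    that the monolith and simplicity statements for the latter carry over to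
    \<open>H\<close>.\<close>
  have "semi_transitive G \<C> H \<and> shiftable G \<C> H"
    if "shift_joinable_compression_family G \<C> H"
    using that
    by (simp add: shift_joinable_compression_family_def joinable_compression_family_def)
  then show ?thesis
    using derived_eq_monolith derived_simple derived_eq_if_shiftable unfolding assms(4) by auto
qed

end
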